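(* Let $a>0$, $\lambda\ge0$, and $C>0$. Consider one of the following cases. Finite endpoint: there are $B>0$, $b\ge0$, an integer $N\ge1$, and $0<\zeta_1<\cdots<\zeta_N<B$ such that $$\Phi(u)=C\,u^{a/2}(B-u)^{b/2}e^{-\lambda u/2}\prod_{j=1}^N\left(1-\frac u{\zeta_j}\right),\qquad 0<u<B.$$ Infinite endpoint: on $(0,\infty)$, $$\Phi(u)=C\,u^{a/2}e^{-\lambda u/2}\prod_{j\in\mathcal J}\left(1-\frac u{\zeta_j}\right),$$ where $\mathcal J$ is finite or countable; for a nonempty product, $0<\zeta_1<\zeta_2<\cdots$, and in the countably infinite case $\sum_j\zeta_j^{-1}<\infty$. The empty product is allowed if $\lambda>0$. If the product is empty put $\zeta_1=\infty$, and in either case set $\Phi(0)=0$ by continuous extension. Then $\Phi$ attains its maximum on $(0,\zeta_1)$ at a unique point $u_1$; write $A=\Phi(u_1)$. Moreover $$\frac{\Phi(tu_1)}A\ge t^{a/2}\left(1+\frac a2(1-t)\right),\qquad 0\le t\le1+\frac2a.$$ Consequently, $$\int_0^{u_1}\frac{\Phi(u)^2}u\,du\ge\frac{A^2}aR(a),\qquad R(a)=1+\frac a{a+1}+\frac{a^2}{2(a+1)(a+2)}=\frac{5a^2+10a+4}{2(a+1)(a+2)}.$$ Define also $$R_*(a):=a\int_0^{1+2/a}t^{a-1}\left(1+\frac a2(1-t)\right)^2dt=\frac{a+2}{2(a+1)}\left(\frac{a+2}a\right)^a$$ (the last equality being part of the assertion). Then $R_*(a)>R(a)$. Put $L=B$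 in the finite-endpoint case and $L=\infty$ in the infinite-endpoint case. If the full inverse moment $$I:=\int_0^L\frac{\Phi(u)^2}u\,du$$ is finite, then $$A^2<\frac{aI}{R_*(a)}.$$ *)

theory Defs
  imports "HOL-Analysis.Analysis"
begin

text \<open>
  The zeros are indexed from 1. The arguments \<open>z\<close> and \<open>L\<close> of the two predicates below are the
  first zero (\<open>\<infinity>\<close> for the empty product) and the right endpoint of the domain of \<open>\<Phi>\<close>.
  Outside the open interval from 0 to \<open>L\<close> the function \<open>\<Phi>\<close> is left unconstrained.
\<close>

definition finite_endpoint ::
  "real \<Rightarrow> real \<Rightarrow> real \<Rightarrow> (real \<Rightarrow> real) \<Rightarrow> ereal \<Rightarrow> ereal \<Rightarrow> bool" where
  "finite_endpoint a lam C \<Phi> z L \<longleftrightarrow>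
    (\<exists>(B::real) (b::real) (N::nat) (\<zeta> :: nat \<Rightarrow> real).
      B > 0 \<and> b \<ge> 0 \<and> N \<ge> 1 \<and>
      strict_mono_on {1..N} \<zeta> \<and> (\<forall>j\<in>{1..N}. 0 < \<zeta> j \<and> \<zeta> j < B) \<and>
      (\<forall>u. 0 < u \<and> u < B \<longrightarrow>
        \<Phi> u = C * u powr (a/2) * (B - u) powr (b/2) * exp (- lam * u / 2)
               * (\<Prod>j=1..N. 1 - u / \<zeta> j)) \<and>
      z = ereal (\<zeta> 1) \<and> L = ereal B)"

definition infinite_endpoint ::
  "real \<Rightarrow> real \<Rightarrow> real \<Rightarrow> (real \<Rightarrow> real) \<Rightarrow> ereal \<Rightarrow> ereal \<Rightarrow> bool" where
  "infinite_endpoint a lam C \<Phi> z L \<longleftrightarrow>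
    L = \<infinity> \<and>
    ((\<exists>(N::nat) (\<zeta> :: nat \<Rightarrow> real).
        (N = 0 \<longrightarrow> lam > 0) \<and>
        strict_mono_on {1..N} \<zeta> \<and> (\<forall>j\<in>{1..N}. 0 < \<zeta> j) \<and>
        (\<forall>u>0. \<Phi> u = C * u powr (a/2) * exp (- lam * u / 2) * (\<Prod>j=1..N. 1 - u / \<zeta> j)) \<and>
        z = (if N = 0 then \<infinity> else ereal (\<zeta> 1)))
     \<or>
     (\<exists>\<zeta> :: nat \<Rightarrow> real.
        strict_mono_on {1..} \<zeta> \<and> (\<forall>j\<ge>1. 0 < \<zeta> j) \<and>
        summable (\<lambda>j. 1 / \<zeta> (Suc j)) \<and>
        (\<forall>u>0. \<Phi> u = C * u powr (a/2) * exp (- lam * u / 2) * (\<Prod>j. 1 - u / \<zeta> (Suc j))) \<and>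
        z = ereal (\<zeta> 1)))"

definition R :: "real \<Rightarrow> real" where
  "R a = 1 + a / (a + 1) + a\<^sup>2 / (2 * (a + 1) * (a + 2))"

definition R_star :: "real \<Rightarrow> real" where
  "R_star a = a * (LBINT t=0..ereal (1 + 2/a). t powr (a - 1) * (1 + a/2 * (1 - t))\<^sup>2)"

definition inverse_moment :: "(real \<Rightarrow> real) \<Rightarrow> ereal \<Rightarrow> ennreal" where
  "inverse_moment \<Phi> L = (\<integral>\<^sup>+u\<in>einterval 0 L. ennreal ((\<Phi> u)\<^sup>2 / u) \<partial>lborel)"

end

theory Submission
  imports Defs "HOL-Real_Asymp.Real_Asymp"
begin

text \<open>
  Write \<open>\<Phi> u = u powr (a/2) * g u\<close>. Up to its first zero \<open>z\<close> the function \<open>g\<close> is positive, decreasing,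
  log-concave and also convex. Log-concavity makes the maximizer \<open>w\<close> unique. Maximality forces the
  supporting line of the convex \<open>g\<close> at \<open>w\<close> to have slope \<open>- (a/2) * g w / w\<close>, which is the lower bound
  \<open>\<Phi> (t * w) / \<Phi> w \<ge> t powr (a/2) * (1 + a/2 * (1 - t))\<close>; evaluated at \<open>z\<close> the same line gives
  \<open>(1 + 2/a) * w \<le> z\<close>. Squaring and integrating yields both integral estimates, and the last one is
  strict because \<open>\<Phi>\<close> does not vanish identically beyond \<open>(1 + 2/a) * w\<close>.
\<close>

subsection \<open>The comparison kernel\<close>

text \<open>Why \<open>g\<close> is convex: a product of nonnegative convex functions is convex once
  all factors decrease. Log-concavity at midpoints is multiplicative as well, so both properties can
  be checked factor by factor and carried to infinite products as limits. The one factor that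
  resists is \<open>(B - u) powr (b/2)\<close>, which is not convex for \<open>0 < b < 2\<close>; it
  is treated jointly with the linear factor of the first zero. The number \<open>1 + 2/a\<close> is
  where the supporting line vanishes once the maximizer is scaled to 1. The line is nonnegative up
  to there, so it may be squared; integrating the square up to \<open>t = 1\<close> or up to
  \<open>t = 1 + 2/a\<close> produces \<open>R\<close> and \<open>R_star\<close>. When there is a
  first zero, only the part of \<open>\<Phi>\<close> before the second zero enters, so finite and
  infinite endpoints share one argument.\<close>

definition kernel :: "real \<Rightarrow> real \<Rightarrow> real" where
  "kernel a t = t powr (a - 1) * (1 + a/2 * (1 - t))\<^sup>2"

text \<open>The antiderivative of \<open>kernel a\<close> that vanishes at 0, found by expanding the
  square of \<open>(1 + a/2) - (a/2) * t\<close> and integrating termwise.\<close>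

definition kernel_prim :: "real \<Rightarrow> real \<Rightarrow> real" where
  "kernel_prim a t = (1 + a/2)\<^sup>2 * t powr a / a - a * (1 + a/2) * t powr (a + 1) / (a + 1)
     + (a/2)\<^sup>2 * t powr (a + 2) / (a + 2)"

lemma kernel_nonneg: "0 \<le> kernel a t"
  by (simp add: kernel_def)

lemma kernel_prim_deriv:
  assumes "a > 0" "t > 0"
  shows "(kernel_prim a has_real_derivative kernel a t) (at t)"
proof -
  have p: "t powr a = t powr (a - 1) * t" "t powr (a + 1) = t powr (a - 1) * t * t"
    using assms powr_add[of t "a - 1" 1] powr_add[of t "a - 1" 2]
    by (simp_all add: power2_eq_square add.commute[of a])
  have D: "((\<lambda>t. k * t powr s / s) has_real_derivative k * t powr (s - 1)) (at t)"
    if "s > 0" for k s :: real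
    using DERIV_cdivide[OF DERIV_cmult[OF has_real_derivative_powr[OF assms(2), of s], of k], of s]
      that by simp
  have "(kernel_prim a has_real_derivative
      (1 + a/2)\<^sup>2 * t powr (a - 1) - a * (1 + a/2) * t powr (a + 1 - 1)
        + (a/2)\<^sup>2 * t powr (a + 2 - 1)) (at t)"
    unfolding kernel_prim_def using assms by (intro DERIV_add DERIV_diff D) auto
  also have "a + 1 - 1 = a" by simp
  also have "a + 2 - 1 = a + 1" by simp
  also have "(1 + a/2)\<^sup>2 * t powr (a - 1) - a * (1 + a/2) * t powr a + (a/2)\<^sup>2 * t powr (a + 1)
      = kernel a t"
  proof -
    have "(1 + k)\<^sup>2 * x - 2 * k * (1 + k) * (x * t) + k\<^sup>2 * (x * t * t) = x * (1 + k * (1 - t))\<^sup>2"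
      for k x :: real by algebra
    from this[of "a/2" "t powr (a - 1)"] show ?thesis unfolding kernel_def p by simp
  qed
  finally show ?thesis .
qed

text \<open>Continuity at 0 has to be shown apart from differentiability: for \<open>a < 1\<close>
  the kernel is unbounded there.\<close>

lemma kernel_prim_continuous:
  assumes "a > 0" shows "continuous_on {0..} (kernel_prim a)"
proof -
  have "continuous_on {0..} (\<lambda>t::real. k * t powr s / s)" if "s > 0" for k s :: real
    using that
    by (intro continuous_on_divide continuous_on_mult continuous_on_powr' continuous_on_const
        continuous_on_id) auto
  then show ?thesis
    unfolding kernel_prim_def using assms
    by (intro continuous_on_add continuous_on_diff) auto
qed

lemma kernel_prim_1:
  assumes "a > 0" shows "a * kernel_prim a 1 = R a"
proof -
  define p q where "p = a + 1" and "q = a + 2"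
  have pq: "p > 0" "q > 0" using assms by (auto simp: p_def q_def)
  have "(1 + a/2)\<^sup>2 - a * a * (1 + a/2) / p + a * (a/2)\<^sup>2 / q = 1 + a / p + a\<^sup>2 / (2 * p * q)"
    using pq by (simp add: divide_simps power2_eq_square) (simp add: p_def q_def, algebra)
  moreover have "a * kernel_prim a 1 = (1 + a/2)\<^sup>2 - a * a * (1 + a/2) / p + a * (a/2)\<^sup>2 / q"
    using assms by (simp add: kernel_prim_def p_def q_def algebra_simps)
  ultimately show ?thesis by (simp add: R_def p_def q_def)
qed

text \<open>With \<open>T = 1 + 2/a\<close> one has \<open>a * T = a + 2\<close>, so after pulling
  out \<open>T powr a\<close> the bracket becomes a rational function of \<open>a\<close>.\<close>

lemma kernel_prim_end:
  assumes "a > 0"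
  shows "a * kernel_prim a (1 + 2/a) = (a + 2) / (2 * (a + 1)) * ((a + 2) / a) powr a"
proof -
  define T where "T = 1 + 2/a"
  have T: "T > 0" "T = (a + 2) / a" using assms by (simp_all add: T_def field_simps add_pos_pos)
  have p: "T powr (a + 1) = T powr a * T" "T powr (a + 2) = T powr a * T\<^sup>2"
    using T(1) by (simp_all add: powr_add)
  have "a * kernel_prim a T = T powr a * 
      ((1 + a/2)\<^sup>2 - a * a * (1 + a/2) * T / (a + 1) + a * (a/2)\<^sup>2 * T\<^sup>2 / (a + 2))"
    unfolding kernel_prim_def p using assms by (simp add: algebra_simps)
  also have "(1 + a/2)\<^sup>2 - a * a * (1 + a/2) * T / (a + 1) + a * (a/2)\<^sup>2 * T\<^sup>2 / (a + 2)
      = (a + 2) / (2 * (a + 1))"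
  proof -
    have aT: "a * T = a + 2" using assms T by simp
    have "a * a * (1 + a/2) * T / (a + 1) = a * (1 + a/2) * (a * T) / (a + 1)" by simp
    also have "\<dots> = a * (a + 2)\<^sup>2 / (2 * (a + 1))"
      unfolding aT using assms by (simp add: divide_simps power2_eq_square)
    finally have "a * a * (1 + a/2) * T / (a + 1) = a * (a + 2)\<^sup>2 / (2 * (a + 1))" .
    moreover have "a * (a/2)\<^sup>2 * T\<^sup>2 / (a + 2) = a * (a * T)\<^sup>2 / (4 * (a + 2))"
      by (simp add: power2_eq_square)
    moreover have "\<dots> = a * (a + 2) / 4"
      unfolding aT power2_eq_square by (subst nonzero_divide_eq_eq) (use assms in auto)
    moreover have "(1 + a/2)\<^sup>2 - a * (a + 2)\<^sup>2 / (2 * (a + 1)) + a * (a + 2) / 4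
        = (a + 2) / (2 * (a + 1))"
      using assms by (simp add: divide_simps power2_eq_square) algebra
    ultimately show ?thesis by presburger
  qed
  finally show ?thesis unfolding T_def[symmetric] T(2) by simp
qed

text \<open>The substitution \<open>t = u / c\<close> is built in, with \<open>c\<close> later the
  maximizer. The fundamental theorem for nonnegative integrands yields integrability and the value
  together, despite the singularity at 0 when \<open>a < 1\<close>.\<close>

lemma kernel_integral:
  assumes "a > 0" "c > 0" "q > 0"
  shows "set_integrable lborel {0<..<q} (\<lambda>u. kernel a (u / c) / c)"
    and "(LBINT u=0..ereal q. kernel a (u / c) / c) = kernel_prim a (q / c)"
proof -
  define F where "F u = kernel_prim a (u / c)" for u
  have d: "(F has_real_derivative kernel a (u / c) / c) (at u)" if "u > 0" for u
  proof -
    have "((\<lambda>u. kernel_prim a (u / c)) has_real_derivative kernel a (u / c) * (1 / c)) (at u)"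
      using that assms by (intro DERIV_chain2[OF kernel_prim_deriv DERIV_cdivide[OF DERIV_ident]]) auto
    then show ?thesis unfolding F_def by simp
  qed
  have cont: "isCont (\<lambda>u. kernel a (u / c) / c) u" if "u > 0" for u
    unfolding kernel_def using that assms by (intro continuous_intros) auto
  have cF: "continuous_on {0..} F"
    unfolding F_def using assms
    by (intro continuous_on_compose2[OF kernel_prim_continuous]) (auto intro!: continuous_intros)
  have F0: "F 0 = 0" using assms by (simp add: F_def kernel_prim_def)
  have "(F \<longlongrightarrow> F 0) (at 0 within {0..})"
    using cF unfolding continuous_on_def by simp
  then have l0: "(F \<longlongrightarrow> 0) (at_right 0)"
    unfolding F0 by (rule tendsto_within_subset) auto
  have lq: "(F \<longlongrightarrow> F q) (at_left q)"
    using DERIV_isCont[OF d[OF assms(3)]] by (simp add: isCont_def filterlim_at_split)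
  have "((F \<circ> real_of_ereal) \<longlongrightarrow> 0) (at_right 0)"
       "((F \<circ> real_of_ereal) \<longlongrightarrow> F q) (at_left (ereal q))"
    using l0 lq by (simp_all add: ereal_tendsto_simps zero_ereal_def)
  note * = interval_integral_FTC_nonneg[of 0 "ereal q" F "\<lambda>u. kernel a (u / c) / c", OF _ _ _ _ this]
  have e: "einterval 0 (ereal q) = {0<..<q}" by (auto simp: einterval_iff)
  show "set_integrable lborel {0<..<q} (\<lambda>u. kernel a (u / c) / c)"
    using *(1) d cont assms unfolding e by (simp add: kernel_nonneg)
  show "(LBINT u=0..ereal q. kernel a (u / c) / c) = kernel_prim a (q / c)"
    using *(2) d cont assms by (simp add: kernel_nonneg F_def)
qed

lemma R_star_eq_kernel_prim: "a > 0 \<Longrightarrow> R_star a = a * kernel_prim a (1 + 2/a)"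
  using kernel_integral(2)[of a 1 "1 + 2/a"] by (simp add: R_star_def kernel_def add_pos_pos)

text \<open>The difference is \<open>a\<close> times the integral of the kernel from 1 to
  \<open>1 + 2/a\<close>, and the linear factor of the kernel is still positive in between.\<close>

lemma R_star_gt_R:
  assumes "a > 0" shows "R_star a > R a"
proof -
  have "kernel_prim a 1 < kernel_prim a (1 + 2/a)"
  proof (rule DERIV_pos_imp_increasing_open[where f = "kernel_prim a"])
    fix x :: real assume x: "1 < x" "x < 1 + 2/a"
    then have "a * x < a + 2" using assms by (simp add: field_simps)
    then have "1 + a/2 * (1 - x) > 0" by (simp add: field_simps)
    then have "kernel a x > 0" using x unfolding kernel_def by simp
    with kernel_prim_deriv[OF assms, of x] x
    show "\<exists>y. (kernel_prim a has_real_derivative y) (at x) \<and> 0 < y" by auto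
  next
    show "continuous_on {1..1 + 2/a} (kernel_prim a)"
      by (rule continuous_on_subset[OF kernel_prim_continuous[OF assms]]) auto
  qed (use assms in simp)
  then show ?thesis
    using assms by (simp add: R_star_eq_kernel_prim flip: kernel_prim_1)
qed

subsection \<open>Power times a convex, log-concave function\<close>

text \<open>Convexity includes the point \<open>z\<close> itself, so that a supporting line can be
  compared with \<open>g z = 0\<close>. \<open>g_mid\<close> is log-concavity in a form without
  logarithms. The bound \<open>M\<close>, later \<open>g 0\<close>, controls \<open>\<Phi>\<close>
  near 0. \<open>tail\<close> supplies an interval beyond a finite \<open>z\<close> on which
  \<open>\<Phi>\<close> does not vanish, the source of the strict inequality.\<close>

locale profile =
  fixes a :: real and z L :: ereal and g \<Phi> :: "real \<Rightarrow> real" and M :: real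
  assumes a_pos: "0 < a" and z_pos: "0 < z"
    and g_pos: "\<And>u. 0 < u \<Longrightarrow> ereal u < z \<Longrightarrow> 0 < g u"
    and g_bdd: "\<And>u. 0 < u \<Longrightarrow> ereal u < z \<Longrightarrow> g u \<le> M"
    and g_convex: "convex_on {u. 0 < u \<and> ereal u \<le> z} g"
    and g_mid: "\<And>u v. 0 < u \<Longrightarrow> ereal u < z \<Longrightarrow> 0 < v \<Longrightarrow> ereal v < z \<Longrightarrow>
                  g u * g v \<le> (g ((u + v) / 2))\<^sup>2"
    and g_end: "\<And>r. z = ereal r \<Longrightarrow> g r = 0"
    and decay: "z = \<infinity> \<Longrightarrow> (\<Phi> \<longlongrightarrow> 0) at_top"
    and Phi: "\<And>u. 0 < u \<Longrightarrow> ereal u \<le> z \<Longrightarrow> \<Phi> u = u powr (a/2) * g u"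
    and Phi_0: "\<Phi> 0 = 0"
    and L_infinite: "z = \<infinity> \<Longrightarrow> L = \<infinity>"
    and tail: "\<And>r. z = ereal r \<Longrightarrow> \<exists>x q. r \<le> x \<and> x < q \<and> ereal q \<le> L \<and>
                 continuous_on {x..q} \<Phi> \<and> (\<forall>u\<in>{x..q}. \<Phi> u \<noteq> 0)"
begin

lemma Phi_pos: "0 < u \<Longrightarrow> ereal u < z \<Longrightarrow> 0 < \<Phi> u"
  using Phi[of u] g_pos[of u] by simp

lemma inner_point: obtains v where "0 < v" "ereal v < z"
proof -
  from ereal_dense2[OF z_pos] obtain v where "0 < ereal v" "ereal v < z" by blast
  then show ?thesis using that[of v] by simp
qed

lemma continuous_g: "continuous_on (einterval 0 z) g"
proof (rule convex_on_continuous[OF open_einterval])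
  have "convex (einterval 0 z)"
    by (auto simp: is_interval_convex_1[symmetric] is_interval_1 einterval_iff
        intro: less_le_trans le_less_trans) (meson ereal_less_eq(3) le_less_trans)
  then show "convex_on (einterval 0 z) g"
    by (intro convex_on_subset[OF g_convex]) (auto simp: einterval_iff)
qed

lemma continuous_Phi: "continuous_on (einterval 0 z) \<Phi>"
proof -
  have "continuous_on (einterval 0 z) (\<lambda>u. u powr (a/2) * g u)"
    by (intro continuous_on_mult continuous_g continuous_on_powr continuous_on_id continuous_on_const)
       (auto simp: einterval_iff)
  then show ?thesis
    by (rule continuous_on_eq) (auto simp: einterval_iff Phi)
qed

lemma tendsto_0: "(\<Phi> \<longlongrightarrow> 0) (at_right 0)"
proof -
  obtain v where v: "0 < v" "ereal v < z" by (rule inner_point)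
  have ev: "eventually (\<lambda>u. u \<in> {0<..<v}) (at_right 0)"
    using v eventually_at_right_real by blast
  have in_z: "ereal u < z" if "u < v" for u using that v(2) by (meson ereal_less_eq(3) le_less_trans less_imp_le)
  show ?thesis
  proof (rule tendsto_sandwich)
    show "eventually (\<lambda>u. 0 \<le> \<Phi> u) (at_right 0)"
      using ev by eventually_elim (use Phi_pos in_z in \<open>auto intro!: less_imp_le\<close>)
    show "eventually (\<lambda>u. \<Phi> u \<le> u powr (a/2) * M) (at_right 0)"
      using ev
    proof eventually_elim
      case (elim u)
      then show ?case using Phi[of u] g_bdd[of u] in_z[of u] by (auto intro!: mult_left_mono)
    qed
    have "((\<lambda>u::real. u powr (a/2)) \<longlongrightarrow> 0) (at_right 0)"
      using tendsto_powr2[of "\<lambda>u. u" 0 "at_right (0::real)" "\<lambda>_. a/2" "a/2"] a_pos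
      by (auto simp: eventually_at_filter intro!: tendsto_ident_at always_eventually)
    from tendsto_mult_right[OF this, of M]
    show "((\<lambda>u::real. u powr (a/2) * M) \<longlongrightarrow> 0) (at_right 0)" by simp
  qed simp
qed

text \<open>Convexity puts \<open>g\<close> below its chord from \<open>r/2\<close> to
  \<open>r\<close>, and this chord vanishes at \<open>r\<close> because
  \<open>g r = 0\<close>.\<close>

lemma tendsto_end:
  assumes "z = ereal r" shows "(\<Phi> \<longlongrightarrow> 0) (at_left r)"
proof -
  have r: "r > 0" using z_pos assms by simp
  have ev: "eventually (\<lambda>u. u \<in> {r/2<..<r}) (at_left r)"
    using r eventually_at_left_real[of "r/2" r] by simp
  define k where "k = r powr (a/2) * (g (r/2) / (r - r/2))"
  have "convex_on {r/2..r} g"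
    using r assms by (intro convex_on_subset[OF g_convex]) auto
  then have gle: "g u \<le> g (r/2) / (r - r/2) * (r - u)" if "u \<in> {r/2<..<r}" for u
    using convex_onD_Icc''[of "r/2" r g u] that g_end[OF assms] by simp
  show ?thesis
  proof (rule tendsto_sandwich)
    show "eventually (\<lambda>u. 0 \<le> \<Phi> u) (at_left r)"
      using ev by eventually_elim (use Phi_pos assms r in \<open>auto intro!: less_imp_le\<close>)
    show "eventually (\<lambda>u. \<Phi> u \<le> k * (r - u)) (at_left r)"
      using ev
    proof eventually_elim
      case (elim u)
      then have u: "0 < u" "u < r" using r by auto
      have "u powr (a/2) * g u \<le> r powr (a/2) * (g (r/2) / (r - r/2) * (r - u))"
        using u gle[OF elim] g_pos[of u] assms a_pos
        by (intro mult_mono powr_mono2) (auto intro: less_imp_le)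
      then show ?case using Phi[of u] u assms by (simp add: k_def mult_ac)
    qed
    have "((\<lambda>u. k * (r - u)) \<longlongrightarrow> k * (r - r)) (at_left r)"
      by (intro tendsto_intros)
    then show "((\<lambda>u. k * (r - u)) \<longlongrightarrow> 0) (at_left r)" by simp
  qed simp
qed

text \<open>Puts a finite first zero and \<open>z = \<infinity>\<close> into one form for the
  compactness argument that follows.\<close>

lemma small_near_end:
  assumes "0 < v" "ereal v < z" "0 < c"
  obtains q where "v \<le> q" "ereal q < z" "\<And>u. q < u \<Longrightarrow> ereal u < z \<Longrightarrow> \<Phi> u < c"
proof (cases z)
  case (real r)
  from order_tendstoD(2)[OF tendsto_end[OF real] \<open>0 < c\<close>]
  obtain b where b: "b < r" "\<And>u. b < u \<Longrightarrow> u < r \<Longrightarrow> \<Phi> u < c"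
    unfolding eventually_at_left_field by blast
  show ?thesis by (rule that[of "max v b"]) (use b assms real in auto)
next
  case PInf
  from order_tendstoD(2)[OF decay[OF PInf] \<open>0 < c\<close>]
  obtain b where b: "\<And>u. b \<le> u \<Longrightarrow> \<Phi> u < c"
    unfolding eventually_at_top_linorder by blast
  show ?thesis by (rule that[of "max v b"]) (use b assms PInf in \<open>auto simp flip: ereal_max\<close>)
qed (use assms in auto)

abbreviation maximizer :: "real \<Rightarrow> bool" where
  "maximizer \<equiv> is_arg_max \<Phi> (\<lambda>u. u \<in> einterval 0 z)"

lemma maximizer_iff:
  "maximizer w \<longleftrightarrow> 0 < w \<and> ereal w < z \<and> (\<forall>u. 0 < u \<longrightarrow> ereal u < z \<longrightarrow> \<Phi> u \<le> \<Phi> w)"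
  by (auto simp: is_arg_max_linorder einterval_iff)

lemma maximizer_exists: "\<exists>w. maximizer w"
proof -
  obtain v where v: "0 < v" "ereal v < z" by (rule inner_point)
  \<comment> \<open>A positive level attained by \<open>\<Phi>\<close>. Near both ends
    \<open>\<Phi>\<close> stays below it, so a maximum over the compact interval
    \<open>{p..q}\<close> containing \<open>v\<close> is global.\<close>
  define c where "c = \<Phi> v"
  have c: "0 < c" unfolding c_def by (rule Phi_pos[OF v])
  from order_tendstoD(2)[OF tendsto_0 c]
  obtain b where b: "b > 0" "\<And>u. 0 < u \<Longrightarrow> u < b \<Longrightarrow> \<Phi> u < c"
    unfolding eventually_at_right_field by blast
  obtain q where q: "v \<le> q" "ereal q < z" "\<And>u. q < u \<Longrightarrow> ereal u < z \<Longrightarrow> \<Phi> u < c"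
    using small_near_end[OF v c] by blast
  define p where "p = min v b"
  have p: "0 < p" "p \<le> v" "\<And>u. 0 < u \<Longrightarrow> u < p \<Longrightarrow> \<Phi> u < c" using v b by (auto simp: p_def)
  have sub: "{p..q} \<subseteq> einterval 0 z"
    using p(1) q(2) by (auto simp: einterval_iff) (meson ereal_less_eq(3) le_less_trans)
  have "\<exists>w\<in>{p..q}. \<forall>u\<in>{p..q}. \<Phi> u \<le> \<Phi> w"
    using p(2) q(1) by (intro continuous_attains_sup continuous_on_subset[OF continuous_Phi sub]) auto
  then obtain w where w: "w \<in> {p..q}" "\<And>u. u \<in> {p..q} \<Longrightarrow> \<Phi> u \<le> \<Phi> w" by blast
  have cw: "c \<le> \<Phi> w" unfolding c_def using p(2) q(1) by (intro w(2)) auto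
  have "\<Phi> u \<le> \<Phi> w" if "0 < u" "ereal u < z" for u
    using that p(3)[of u] q(3)[of u] w(2)[of u] cw by (cases "u < p"; cases "q < u") auto
  moreover have "w \<in> einterval 0 z" using w(1) sub by blast
  ultimately have "maximizer w" unfolding maximizer_iff by (simp add: einterval_iff)
  then show ?thesis ..
qed

text \<open>Strictness comes from the power alone, since \<open>g_mid\<close> may hold with
  equality: for distinct \<open>u\<close> and \<open>v\<close> with midpoint \<open>m\<close>,
  \<open>u * v < m\<^sup>2\<close>, so \<open>\<Phi> m\<close> would exceed the maximum.\<close>

lemma maximizer_unique:
  assumes "maximizer u" "maximizer v" shows "u = v"
proof (rule ccontr)
  assume ne: "u \<noteq> v"
  from assms have u: "0 < u" "ereal u < z" and v: "0 < v" "ereal v < z" and eq: "\<Phi> u = \<Phi> v"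
    by (auto simp: maximizer_iff intro: antisym)
  define m where "m = (u + v) / 2"
  have m: "0 < m" "ereal m < z"
  proof -
    show "0 < m" using u v by (simp add: m_def)
    have "m \<le> max u v" by (simp add: m_def max_def)
    then have "ereal m \<le> ereal (max u v)" by (simp only: ereal_less_eq)
    also have "\<dots> < z" using u v by (simp add: max_def)
    finally show "ereal m < z" .
  qed
  have "u * v < m\<^sup>2"
  proof -
    have "m\<^sup>2 - u * v = ((u - v) / 2)\<^sup>2" by (simp add: m_def power2_eq_square field_simps)
    moreover have "\<dots> > 0" using ne by simp
    ultimately show ?thesis by linarith
  qed
  then have "(u * v) powr (a/2) < (m\<^sup>2) powr (a/2)"
    using u v a_pos by (intro powr_less_mono2) auto
  then have pw: "u powr (a/2) * v powr (a/2) < (m powr (a/2))\<^sup>2"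
    using u v m by (simp add: powr_mult power2_eq_square)
  have "(\<Phi> u)\<^sup>2 = \<Phi> u * \<Phi> v" using eq by (simp add: power2_eq_square)
  also have "\<dots> = (u powr (a/2) * v powr (a/2)) * (g u * g v)"
    using Phi[of u] Phi[of v] u v by simp
  also have "\<dots> < (m powr (a/2))\<^sup>2 * (g u * g v)"
    using pw g_pos u v by (intro mult_strict_right_mono) auto
  also have "\<dots> \<le> (m powr (a/2))\<^sup>2 * (g m)\<^sup>2"
    using g_mid[OF u v] by (intro mult_left_mono) (auto simp: m_def)
  also have "\<dots> = (\<Phi> m)\<^sup>2" using Phi[of m] m by (simp add: power_mult_distrib)
  finally have "\<Phi> u < \<Phi> m" using Phi_pos[OF m] by (meson less_imp_le power_less_imp_less_base)
  then show False using assms(1) m by (auto simp: maximizer_iff not_le[symmetric])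
qed

text \<open>
  No differentiability of \<open>g\<close> is needed: multiplied by \<open>u powr (a/2)\<close>, any supporting line of \<open>g\<close>
  at the maximizer \<open>w\<close> lies below \<open>\<Phi>\<close> and touches it at \<open>w\<close>, which determines its slope.
\<close>

lemma above_line:
  assumes w: "maximizer w" and u: "0 < u" "ereal u \<le> z"
  shows "g w * (1 + a/2 * (1 - u / w)) \<le> g u"
proof -
  define I where "I = {u. 0 < u \<and> ereal u \<le> z}"
  from w have w0: "0 < w" "ereal w < z" and wmax: "\<And>u. 0 < u \<Longrightarrow> ereal u < z \<Longrightarrow> \<Phi> u \<le> \<Phi> w"
    by (auto simp: maximizer_iff)
  have "einterval 0 z \<subseteq> interior I"
    by (rule interior_maximal) (auto simp: I_def einterval_iff)
  then have wI: "w \<in> interior I" using w0 by (auto simp: einterval_iff)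
  \<comment> \<open>The infimum of the chord slopes to the right of \<open>w\<close>, that is, the
    right derivative of the convex \<open>g\<close> at \<open>w\<close>; it is the slope of a
    supporting line.\<close>
  define m where "m = Inf ((\<lambda>t. (g w - g t) / (w - t)) ` ({w<..} \<inter> I))"
  have line: "g w + m * (y - w) \<le> g y" if "y \<in> I" for y
    unfolding m_def by (rule convex_le_Inf_differential[OF _ wI that]) (use g_convex in \<open>simp add: I_def\<close>)
  define H where "H y = y powr (a/2) * (g w + m * (y - w))" for y
  have dH: "(H has_real_derivative a/2 * w powr (a/2 - 1) * g w + w powr (a/2) * m) (at w)"
  proof -
    have "((\<lambda>y. g w + m * (y - w)) has_real_derivative m) (at w)"
      by (auto intro!: derivative_eq_intros)
    from DERIV_mult[OF has_real_derivative_powr[OF w0(1), of "a/2"] this]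
    show ?thesis unfolding H_def by (simp add: mult_ac)
  qed
  obtain d where d: "d > 0" "ball w d \<subseteq> einterval 0 z"
    using w0 open_einterval[of 0 z] by (metis einterval_iff ereal_less(2) openE)
  have "a/2 * w powr (a/2 - 1) * g w + w powr (a/2) * m = 0"
  proof (rule DERIV_local_max[OF dH d(1)], intro allI impI)
    fix y assume "\<bar>w - y\<bar> < d"
    then have y: "0 < y" "ereal y < z" using d(2) by (auto simp: einterval_iff subset_iff dist_real_def)
    have "H y \<le> \<Phi> y" unfolding H_def Phi[OF y(1) less_imp_le[OF y(2)]]
      using line[of y] y by (intro mult_left_mono) (auto simp: I_def)
    also have "\<dots> \<le> \<Phi> w" by (rule wmax[OF y])
    also have "\<dots> = H w" using Phi[of w] w0 by (simp add: H_def)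
    finally show "H y \<le> H w" .
  qed
  moreover have "w powr (a/2) = w powr (a/2 - 1) * w"
    using w0 powr_add[of w "a/2 - 1" 1] by simp
  ultimately have "w powr (a/2 - 1) * (a/2 * g w + w * m) = 0" by (simp add: algebra_simps)
  then have "a/2 * g w + w * m = 0" using w0 by simp
  then have m: "m = - (a/2 * g w / w)" using w0 by (simp add: field_simps)
  have "g w * (1 + a/2 * (1 - u / w)) = g w + m * (u - w)"
    unfolding m using w0 by (simp add: field_simps)
  also have "\<dots> \<le> g u" using u by (intro line) (auto simp: I_def)
  finally show ?thesis .
qed

lemma stretch_le:
  assumes w: "maximizer w" shows "ereal ((1 + 2/a) * w) \<le> z"
proof (cases z)
  case (real r)
  from w have w0: "0 < w" "ereal w < z" by (auto simp: maximizer_iff)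
  have r: "0 < r" using real z_pos by simp
  have "g w * (1 + a/2 * (1 - r / w)) \<le> 0"
    using above_line[OF w r] g_end[OF real] real by simp
  then have "1 + a/2 * (1 - r / w) \<le> 0"
    using g_pos[OF w0] by (simp add: mult_le_0_iff)
  then have "(1 + 2/a) * w \<le> r" using a_pos w0 by (simp add: field_simps)
  then show ?thesis using real by simp
qed (use z_pos in auto)

lemma lower_bound:
  assumes w: "maximizer w" and t: "0 \<le> t" "t \<le> 1 + 2/a"
  shows "t powr (a/2) * (1 + a/2 * (1 - t)) \<le> \<Phi> (t * w) / \<Phi> w"
proof (cases "t = 0")
  case False
  from w have w0: "0 < w" "ereal w < z" by (auto simp: maximizer_iff)
  have "ereal (t * w) \<le> ereal ((1 + 2/a) * w)" using t w0 by (simp add: mult_right_mono)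
  then have tw: "0 < t * w" "ereal (t * w) \<le> z"
    using stretch_le[OF w] t w0 False by (simp, blast intro: order_trans)
  have "t powr (a/2) * (1 + a/2 * (1 - t)) * \<Phi> w
      = (t * w) powr (a/2) * (g w * (1 + a/2 * (1 - t * w / w)))"
    using Phi[of w] w0 t by (simp add: powr_mult)
  also have "\<dots> \<le> (t * w) powr (a/2) * g (t * w)"
    by (intro mult_left_mono above_line[OF w tw]) auto
  also have "\<dots> = \<Phi> (t * w)" using Phi[OF tw] by simp
  finally show ?thesis using Phi_pos[OF w0] by (simp add: le_divide_eq)
\<comment> \<open>At \<open>t = 0\<close> both sides are 0, because \<open>0 powr (a/2) = 0\<close>
  and \<open>\<Phi> 0 = 0\<close>.\<close>
qed (simp add: Phi_0)

section \<open>Integral estimates\<close>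

text \<open>Squaring \<open>lower_bound\<close> is legitimate because the linear factor is
  nonnegative up to \<open>1 + 2/a\<close>. Division by \<open>u = t * w\<close> lowers the exponent
  \<open>a\<close> to the \<open>a - 1\<close> of the kernel and leaves
  \<open>1 / w\<close>.\<close>

lemma kernel_le:
  assumes w: "maximizer w" and u: "0 < u" "u \<le> (1 + 2/a) * w"
  shows "(\<Phi> w)\<^sup>2 * (kernel a (u / w) / w) \<le> (\<Phi> u)\<^sup>2 / u"
proof -
  from w have w0: "0 < w" "ereal w < z" by (auto simp: maximizer_iff)
  define t where "t = u / w"
  have t: "0 < t" "t \<le> 1 + 2/a" "u = t * w" using u w0 by (auto simp: t_def field_simps)
  have A: "0 < \<Phi> w" by (rule Phi_pos[OF w0])
  have nn: "0 \<le> 1 + a/2 * (1 - t)" using t(2) a_pos by (simp add: field_simps)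
  have "\<Phi> w * (t powr (a/2) * (1 + a/2 * (1 - t))) \<le> \<Phi> u"
    using lower_bound[OF w, of t] t A by (simp add: le_divide_eq mult.commute)
  then have "(\<Phi> w * (t powr (a/2) * (1 + a/2 * (1 - t))))\<^sup>2 \<le> (\<Phi> u)\<^sup>2"
    using A nn by (intro power_mono) auto
  moreover have "(\<Phi> w * (t powr (a/2) * (1 + a/2 * (1 - t))))\<^sup>2 = (\<Phi> w)\<^sup>2 * (kernel a t / w) * u"
  proof -
    have "(t powr (a/2))\<^sup>2 = t powr (a - 1) * t"
      using t(1) powr_add[of t "a - 1" 1] powr_add[of t "a/2" "a/2"] by (simp add: power2_eq_square)
    then show ?thesis using w0 t(3) by (simp add: power_mult_distrib kernel_def)
  qed
  ultimately show ?thesis using u by (simp add: le_divide_eq t_def)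
qed

text \<open>Provides the integrable majorant near 0. The kernel can be reused for this purpose since
  its linear factor is at least 1 to the left of the maximizer.\<close>

lemma square_le_kernel:
  assumes w: "maximizer w" and u: "0 < u" "u < w"
  shows "(\<Phi> u)\<^sup>2 / u \<le> M\<^sup>2 * w powr a * (kernel a (u / w) / w)"
proof -
  from w have w0: "0 < w" "ereal w < z" by (auto simp: maximizer_iff)
  have uz: "ereal u < z" using u w0 by (meson ereal_less_eq(3) le_less_trans less_imp_le)
  have sq: "(u powr (a/2))\<^sup>2 = u powr (a - 1) * u"
    using u powr_add[of u "a - 1" 1] powr_add[of u "a/2" "a/2"] by (simp add: power2_eq_square)
  have "(\<Phi> u)\<^sup>2 / u = u powr (a - 1) * (g u)\<^sup>2"
    using Phi[of u] u uz sq by (simp add: power_mult_distrib)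
  also have "\<dots> \<le> u powr (a - 1) * M\<^sup>2"
    using g_bdd[OF u(1) uz] g_pos[OF u(1) uz] by (intro mult_left_mono power_mono) auto
  also have "u powr (a - 1) = w powr (a - 1) * (u / w) powr (a - 1)"
    using u w0 by (simp flip: powr_mult)
  also have "\<dots> \<le> w powr (a - 1) * kernel a (u / w)"
  proof (intro mult_left_mono)
    have "1 \<le> 1 + a/2 * (1 - u / w)" using u w0 a_pos by simp
    then have "1 \<le> (1 + a/2 * (1 - u / w))\<^sup>2" by (simp add: one_le_power)
    then show "(u / w) powr (a - 1) \<le> kernel a (u / w)"
      unfolding kernel_def using mult_left_mono[of 1 _ "(u / w) powr (a - 1)"] by simp
  qed simp
  also have "w powr (a - 1) = w powr a / w"
    using w0 by (simp add: powr_diff)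
  finally show ?thesis by (simp add: mult_ac mult_right_mono)
qed

lemma integral_lower_bound:
  assumes w: "maximizer w"
  shows "(\<Phi> w)\<^sup>2 / a * R a \<le> (LBINT u=0..ereal w. (\<Phi> u)\<^sup>2 / u)"
proof -
  from w have w0: "0 < w" "ereal w < z" by (auto simp: maximizer_iff)
  note ker = kernel_integral[OF a_pos w0(1) w0(1)]
  have e: "einterval 0 (ereal w) = {0<..<w}" by (auto simp: einterval_iff)
  have sub: "{0<..<w} \<subseteq> einterval 0 z"
    using w0 by (auto simp: einterval_iff) (meson ereal_less_eq(3) le_less_trans less_imp_le)
  have meas: "set_borel_measurable lborel {0<..<w} (\<lambda>u. (\<Phi> u)\<^sup>2 / u)"
  proof -
    have "continuous_on {0<..<w} (\<lambda>u. (\<Phi> u)\<^sup>2 / u)"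
      by (intro continuous_intros continuous_on_subset[OF continuous_Phi sub]) auto
    then have "(\<lambda>u. indicator {0<..<w} u *\<^sub>R ((\<Phi> u)\<^sup>2 / u)) \<in> borel_measurable borel"
      by (intro borel_measurable_continuous_on_indicator) auto
    then show ?thesis by (simp add: set_borel_measurable_def)
  qed
  \<comment> \<open>Indispensable for a lower bound: the Lebesgue integral of a non-integrable
    function is 0 by convention.\<close>
  have int: "set_integrable lborel {0<..<w} (\<lambda>u. (\<Phi> u)\<^sup>2 / u)"
  proof (rule set_integrable_bound[OF _ meas])
    show "set_integrable lborel {0<..<w} (\<lambda>u. M\<^sup>2 * w powr a * (kernel a (u / w) / w))"
      using ker(1) by (rule set_integrable_mult_right)
    show "AE u in lborel. u \<in> {0<..<w} \<longrightarrow>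
        norm ((\<Phi> u)\<^sup>2 / u) \<le> norm (M\<^sup>2 * w powr a * (kernel a (u / w) / w))"
      using square_le_kernel[OF w] w0 kernel_nonneg by (auto simp: abs_mult)
  qed
  have "(\<Phi> w)\<^sup>2 / a * R a = (\<Phi> w)\<^sup>2 * (LBINT u=0..ereal w. kernel a (u / w) / w)"
    unfolding ker(2) kernel_prim_1[OF a_pos, symmetric] using w0 a_pos by simp
  also have "\<dots> = (LBINT u:{0<..<w}. (\<Phi> w)\<^sup>2 * (kernel a (u / w) / w))"
    using w0 by (simp add: interval_lebesgue_integral_def e)
  also have "\<dots> \<le> (LBINT u:{0<..<w}. (\<Phi> u)\<^sup>2 / u)"
  proof (rule set_integral_mono[OF set_integrable_mult_right[OF ker(1)] int])
    fix u assume "u \<in> {0<..<w}"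
    moreover from this have "u \<le> (1 + 2/a) * w"
      using a_pos w0 by (simp add: distrib_right add_increasing2)
    ultimately show "(\<Phi> w)\<^sup>2 * (kernel a (u / w) / w) \<le> (\<Phi> u)\<^sup>2 / u"
      using kernel_le[OF w] by simp
  qed
  also have "\<dots> = (LBINT u=0..ereal w. (\<Phi> u)\<^sup>2 / u)"
    using w0 by (simp add: interval_lebesgue_integral_def e)
  finally show ?thesis .
qed

text \<open>\<open>\<delta>\<close> is the minimum of \<open>(\<Phi> u)\<^sup>2 / u\<close> on a
  compact interval beyond \<open>p\<close>. If \<open>z\<close> is infinite,
  \<open>{p..p + 1}\<close> serves because \<open>\<Phi>\<close> is positive on the whole
  half-line.\<close>

lemma tail_at:
  assumes p: "0 < p" "ereal p \<le> z"
  obtains x q \<delta> where "p \<le> x" "x < q" "ereal q \<le> L" "0 < \<delta>" "\<And>u. u \<in> {x..q} \<Longrightarrow> \<delta> \<le> (\<Phi> u)\<^sup>2 / u"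
proof -
  have "\<exists>x q. p \<le> x \<and> x < q \<and> ereal q \<le> L \<and> continuous_on {x..q} \<Phi> \<and> (\<forall>u\<in>{x..q}. \<Phi> u \<noteq> 0)"
  proof (cases z)
    case (real r)
    then have "p \<le> r" using p by simp
    with tail[OF real] show ?thesis by (meson order_trans)
  next
    case PInf
    have "continuous_on {p..p + 1} \<Phi>"
      using p PInf by (intro continuous_on_subset[OF continuous_Phi]) (auto simp: einterval_iff)
    moreover have "\<forall>u\<in>{p..p + 1}. \<Phi> u \<noteq> 0"
      using Phi_pos PInf p by (metis atLeastAtMost_iff less_ereal.simps(4) less_le less_le_trans)
    ultimately show ?thesis
      using L_infinite[OF PInf] by (intro exI[of _ p] exI[of _ "p + 1"]) auto
  qed (use p in auto)
  then obtain x q where xq: "p \<le> x" "x < q" "ereal q \<le> L" "continuous_on {x..q} \<Phi>"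
    and nz: "\<And>u. u \<in> {x..q} \<Longrightarrow> \<Phi> u \<noteq> 0" by blast
  have "continuous_on {x..q} (\<lambda>u. (\<Phi> u)\<^sup>2 / u)"
    using xq p by (intro continuous_intros) auto
  then obtain v where v: "v \<in> {x..q}" "\<And>u. u \<in> {x..q} \<Longrightarrow> (\<Phi> v)\<^sup>2 / v \<le> (\<Phi> u)\<^sup>2 / u"
    using continuous_attains_inf[of "{x..q}" "\<lambda>u. (\<Phi> u)\<^sup>2 / u"] xq by auto
  have "0 < (\<Phi> v)\<^sup>2 / v" using nz[OF v(1)] v(1) xq p by simp
  then show ?thesis using that[OF xq(1-3) _ v(2)] by blast
qed

text \<open>The kernel contributes \<open>K\<close> over the interval from 0 to \<open>p\<close>,
  where \<open>a * K\<close> equals \<open>(\<Phi> w)\<^sup>2 * R_star a\<close>; the tail adds at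
  least \<open>\<delta> * (q - x) > 0\<close>. Nonnegative integrals let the comparison rest on a
  pointwise bound, although the locale says nothing about the regularity of \<open>\<Phi>\<close>
  far beyond \<open>z\<close>.\<close>

lemma inverse_moment_bound:
  assumes w: "maximizer w" and fin: "inverse_moment \<Phi> L < \<infinity>"
  shows "(\<Phi> w)\<^sup>2 < a * enn2real (inverse_moment \<Phi> L) / R_star a"
proof -
  from w have w0: "0 < w" "ereal w < z" by (auto simp: maximizer_iff)
  define p where "p = (1 + 2/a) * w"
  have p: "0 < p" "ereal p \<le> z" using a_pos w0 stretch_le[OF w] by (auto simp: p_def add_pos_pos)
  obtain x q \<delta> where xq: "p \<le> x" "x < q" "ereal q \<le> L" "0 < \<delta>"
    and \<delta>: "\<And>u. u \<in> {x..q} \<Longrightarrow> \<delta> \<le> (\<Phi> u)\<^sup>2 / u" by (rule tail_at[OF p]) blast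
  note ker = kernel_integral[OF a_pos w0(1) p(1)]
  define K where "K = (\<Phi> w)\<^sup>2 * kernel_prim a (1 + 2/a)"
  define k where "k u = (\<Phi> w)\<^sup>2 * (kernel a (u / w) / w)" for u
  have k0: "0 \<le> k u" for u using w0 by (simp add: k_def kernel_nonneg)
  have meas: "k \<in> borel_measurable borel"
    unfolding k_def kernel_def by measurable
  have e: "einterval 0 (ereal p) = {0<..<p}" by (auto simp: einterval_iff)
  have kint: "set_integrable lborel {0<..<p} k"
    unfolding k_def by (rule set_integrable_mult_right[OF ker(1)])
  have "(LBINT u:{0<..<p}. k u) = (\<Phi> w)\<^sup>2 * (LBINT u=0..ereal p. kernel a (u / w) / w)"
    using p by (simp add: interval_lebesgue_integral_def e k_def)
  also have "\<dots> = K" using ker(2) w0 by (simp add: K_def p_def)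
  finally have kK: "(LBINT u:{0<..<p}. k u) = K" .
  have nnk: "(\<integral>\<^sup>+u. ennreal (k u) * indicator {0<..<p} u \<partial>lborel) = ennreal K"
  proof -
    have "(\<integral>\<^sup>+u. ennreal (k u) * indicator {0<..<p} u \<partial>lborel)
        = (\<integral>\<^sup>+u. ennreal (indicator {0<..<p} u *\<^sub>R k u) \<partial>lborel)"
      by (intro nn_integral_cong) (auto simp: indicator_def)
    also have "\<dots> = ennreal (LBINT u:{0<..<p}. k u)"
      unfolding set_lebesgue_integral_def
      using kint k0 unfolding set_integrable_def
      by (intro nn_integral_eq_integral) (auto simp: indicator_def)
    finally show ?thesis unfolding kK .
  qed
  have K0: "0 \<le> K"
    unfolding kK[symmetric] set_lebesgue_integral_def using k0
    by (intro integral_nonneg_AE) (auto simp: indicator_def)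
  have "ennreal (K + \<delta> * (q - x)) = ennreal K + ennreal \<delta> * ennreal (q - x)"
    using K0 xq by (simp add: ennreal_plus ennreal_mult)
  also have "\<dots> = (\<integral>\<^sup>+u. ennreal (k u) * indicator {0<..<p} u \<partial>lborel)
      + (\<integral>\<^sup>+u. ennreal \<delta> * indicator {x<..<q} u \<partial>lborel)"
    using xq by (simp add: nnk nn_integral_cmult_indicator)
  also have "\<dots> = (\<integral>\<^sup>+u. ennreal (k u) * indicator {0<..<p} u + ennreal \<delta> * indicator {x<..<q} u \<partial>lborel)"
    using meas by (intro nn_integral_add[symmetric]) auto
  also have "\<dots> \<le> inverse_moment \<Phi> L"
    unfolding inverse_moment_def
  proof (intro nn_integral_mono)
    fix u :: real
    have inL: "u \<in> einterval 0 L" if "0 < u" "u < q"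
      using that xq(3) by (auto simp: einterval_iff) (meson ereal_less_eq(3) le_less_trans less_le_trans less_ereal.simps(1))
    show "ennreal (k u) * indicator {0<..<p} u + ennreal \<delta> * indicator {x<..<q} u
        \<le> ennreal ((\<Phi> u)\<^sup>2 / u) * indicator (einterval 0 L) u"
    \<comment> \<open>Since \<open>p \<le> x\<close>, at most one of the two indicators is
      nonzero.\<close>
    proof (cases "u \<in> {0<..<p}")
      case True
      then show ?thesis
        using inL xq kernel_le[OF w, of u] by (auto simp: k_def p_def intro!: ennreal_leI)
    next
      case False
      then show ?thesis
        using inL xq p \<delta>[of u] by (auto simp: indicator_def intro!: ennreal_leI)
    qed
  qed
  finally have "K + \<delta> * (q - x) \<le> enn2real (inverse_moment \<Phi> L)"
    using fin by (cases "inverse_moment \<Phi> L") auto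
  moreover have "0 < \<delta> * (q - x)" using xq by simp
  ultimately have K: "K < enn2real (inverse_moment \<Phi> L)" by linarith
  have R: "0 < R_star a"
    unfolding R_star_eq_kernel_prim[OF a_pos] kernel_prim_end[OF a_pos] using a_pos
    by (intro mult_pos_pos divide_pos_pos) auto
  have "(\<Phi> w)\<^sup>2 * R_star a = a * K"
    using a_pos by (simp add: K_def R_star_eq_kernel_prim)
  also have "\<dots> < a * enn2real (inverse_moment \<Phi> L)" using K a_pos by simp
  finally show ?thesis using R by (simp add: less_divide_eq)
qed

end

subsection \<open>Convexity and log-concavity of the factors\<close>

text \<open>Monotonicity and nonnegativity are included to make the class closed under products. The
  quadratic form of log-concavity tolerates zeros of \<open>f\<close>.\<close>

definition profile_factor :: "real set \<Rightarrow> (real \<Rightarrow> real) \<Rightarrow> bool" where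
  "profile_factor S f \<longleftrightarrow> convex_on S f \<and> antimono_on S f \<and> (\<forall>x\<in>S. 0 \<le> f x) \<and>
     (\<forall>x\<in>S. \<forall>y\<in>S. f x * f y \<le> (f ((x + y) / 2))\<^sup>2)"

lemma profile_factorD:
  assumes "profile_factor S f"
  shows "convex_on S f" "convex S" "antimono_on S f"
    "x \<in> S \<Longrightarrow> 0 \<le> f x" "x \<in> S \<Longrightarrow> y \<in> S \<Longrightarrow> x \<le> y \<Longrightarrow> f y \<le> f x"
    "x \<in> S \<Longrightarrow> y \<in> S \<Longrightarrow> f x * f y \<le> (f ((x + y) / 2))\<^sup>2"
  using assms by (auto simp: profile_factor_def convex_on_imp_convex monotone_on_def)

text \<open>Reflection \<open>x \<mapsto> - x\<close> preserves convexity and turns decreasing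
  factors into increasing ones, for which \<open>convex_on_mul\<close> applies.\<close>

lemma convex_on_mul_antimono:
  fixes S :: "real set"
  assumes "convex_on S f" "convex_on S g" "antimono_on S f" "antimono_on S g"
    and "f \<in> S \<rightarrow> {0..}" "g \<in> S \<rightarrow> {0..}"
  shows "convex_on S (\<lambda>x. f x * g x)"
proof -
  let ?S = "uminus ` S"
  have flip: "convex_on T (\<lambda>x. h (- x))" if "convex_on (uminus ` T) h" for T and h :: "real \<Rightarrow> real"
  proof (rule convex_onI)
    show "convex T"
      using convex_negations[OF convex_on_imp_convex[OF that]] by (simp add: image_image)
    fix t x y :: real assume "0 < t" "t < 1" "x \<in> T" "y \<in> T"
    with convex_onD[OF that, of t "- x" "- y"]
    show "h (- ((1 - t) *\<^sub>R x + t *\<^sub>R y)) \<le> (1 - t) * h (- x) + t * h (- y)" by simp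
  qed
  have "convex_on ?S (\<lambda>x. f (- x) * g (- x))"
  proof (rule convex_on_mul)
    show "convex_on ?S (\<lambda>x. f (- x))" "convex_on ?S (\<lambda>x. g (- x))"
      using assms(1,2) by (auto intro!: flip simp: image_image)
    show "mono_on ?S (\<lambda>x. f (- x))" "mono_on ?S (\<lambda>x. g (- x))"
      using assms(3,4) by (auto simp: monotone_on_def)
  qed (use assms(5,6) in auto)
  from flip[OF this] show ?thesis by simp
qed

lemma midpoint_log_concave_mult:
  fixes f g :: "real \<Rightarrow> real"
  assumes "f x * f y \<le> (f m)\<^sup>2" "g x * g y \<le> (g m)\<^sup>2" "0 \<le> g x" "0 \<le> g y"
  shows "(f x * g x) * (f y * g y) \<le> (f m * g m)\<^sup>2"
proof -
  have "(f x * f y) * (g x * g y) \<le> (f m)\<^sup>2 * (g m)\<^sup>2"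
    using assms by (intro mult_mono) auto
  then show ?thesis by (simp add: power_mult_distrib mult_ac)
qed

lemma profile_factor_mult:
  assumes f: "profile_factor S f" and g: "profile_factor S g"
  shows "profile_factor S (\<lambda>x. f x * g x)"
  unfolding profile_factor_def
proof (intro conjI ballI)
  show "convex_on S (\<lambda>x. f x * g x)"
    using profile_factorD[OF f] profile_factorD[OF g] by (intro convex_on_mul_antimono) auto
  show "antimono_on S (\<lambda>x. f x * g x)"
    using profile_factorD[OF f] profile_factorD[OF g] by (auto intro!: monotone_onI mult_mono)
  fix x assume x: "x \<in> S"
  show "0 \<le> f x * g x" using profile_factorD(4)[OF f x] profile_factorD(4)[OF g x] by simp
  fix y assume y: "y \<in> S"
  show "f x * g x * (f y * g y) \<le> (f ((x + y) / 2) * g ((x + y) / 2))\<^sup>2"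
    using profile_factorD[OF f] profile_factorD[OF g] x y by (intro midpoint_log_concave_mult) auto
qed

lemma profile_factor_const: "convex S \<Longrightarrow> 0 \<le> k \<Longrightarrow> profile_factor S (\<lambda>_. k)"
  by (auto simp: profile_factor_def convex_on_const monotone_on_def power2_eq_square)

lemma profile_factor_linear:
  assumes "convex S" "0 \<le> k" "\<And>x. x \<in> S \<Longrightarrow> k * x \<le> 1"
  shows "profile_factor S (\<lambda>x. 1 - k * x)"
  unfolding profile_factor_def
proof (intro conjI ballI)
  show "convex_on S (\<lambda>x. 1 - k * x)"
    by (intro convex_onI assms(1)) (simp add: algebra_simps)
  show "antimono_on S (\<lambda>x. 1 - k * x)"
    using assms(2) by (auto intro!: monotone_onI mult_left_mono)
  fix x assume "x \<in> S"
  then show "0 \<le> 1 - k * x" using assms(3) by simp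
  fix y
  have "(1 - k * ((x + y) / 2))\<^sup>2 - (1 - k * x) * (1 - k * y) = (k * (x - y) / 2)\<^sup>2"
    by (simp add: power2_eq_square field_simps)
  then show "(1 - k * x) * (1 - k * y) \<le> (1 - k * ((x + y) / 2))\<^sup>2"
    by (metis diff_ge_0_iff_ge zero_le_power2)
qed

lemma profile_factor_exp:
  assumes "convex S" "0 \<le> k"
  shows "profile_factor S (\<lambda>x. exp (- k * x / 2))"
  unfolding profile_factor_def
proof (intro conjI ballI)
  show "convex_on S (\<lambda>x. exp (- k * x / 2))"
    by (rule f''_ge0_imp_convex[OF assms(1), where f' = "\<lambda>x. - k / 2 * exp (- k * x / 2)"
          and f'' = "\<lambda>x. (k / 2)\<^sup>2 * exp (- k * x / 2)"])
       (auto intro!: derivative_eq_intros simp: power2_eq_square)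
  show "antimono_on S (\<lambda>x. exp (- k * x / 2))"
    using assms(2) by (auto intro!: monotone_onI mult_left_mono)
  fix x y :: real
  have "exp (- k * x / 2) * exp (- k * y / 2) = (exp (- k * ((x + y) / 2) / 2))\<^sup>2"
    by (simp add: power2_eq_square field_simps flip: exp_add)
  then show "exp (- k * x / 2) * exp (- k * y / 2) \<le> (exp (- k * ((x + y) / 2) / 2))\<^sup>2" by simp
qed simp

lemma profile_factor_prod:
  assumes "convex S" "\<And>i. i \<in> A \<Longrightarrow> profile_factor S (f i)"
  shows "profile_factor S (\<lambda>x. \<Prod>i\<in>A. f i x)"
  using assms(2)
proof (induction A rule: infinite_finite_induct)
  case (insert i A)
  then show ?case using profile_factor_mult[of S "f i"] by simp
qed (use assms(1) in \<open>auto intro!: profile_factor_const\<close>)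

text \<open>Every defining condition is a non-strict inequality between values at finitely many
  points, hence survives pointwise limits. Strict positivity does not, and is supplied separately
  for infinite products.\<close>

lemma profile_factor_LIMSEQ:
  assumes f: "\<And>n. profile_factor S (f n)" and lim: "\<And>x. x \<in> S \<Longrightarrow> (\<lambda>n. f n x) \<longlonglongrightarrow> h x"
  shows "profile_factor S h"
  unfolding profile_factor_def
proof (intro conjI ballI)
  have S: "convex S" by (rule profile_factorD(2)[OF f])
  have mem: "(1 - t) * x + t * y \<in> S" if "0 \<le> t" "t \<le> 1" "x \<in> S" "y \<in> S" for t x y
    using S that by (auto simp: convex_alt)
  show "convex_on S h"
  proof (rule convex_onI[OF _ S])
    fix t x y :: real assume t: "0 < t" "t < 1" and xy: "x \<in> S" "y \<in> S"
    have "h ((1 - t) * x + t * y) \<le> (1 - t) * h x + t * h y"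
    proof (rule tendsto_le[OF trivial_limit_sequentially])
      show "(\<lambda>n. (1 - t) * f n x + t * f n y) \<longlonglongrightarrow> (1 - t) * h x + t * h y"
        using xy by (intro tendsto_intros lim)
      show "(\<lambda>n. f n ((1 - t) * x + t * y)) \<longlonglongrightarrow> h ((1 - t) * x + t * y)"
        using t xy by (intro lim mem) auto
      show "eventually (\<lambda>n. f n ((1 - t) * x + t * y) \<le> (1 - t) * f n x + t * f n y) sequentially"
        using convex_onD[OF profile_factorD(1)[OF f]] t xy by (intro always_eventually) simp
    qed
    then show "h ((1 - t) *\<^sub>R x + t *\<^sub>R y) \<le> (1 - t) * h x + t * h y" by simp
  qed
  show "antimono_on S h"
  proof (rule monotone_onI)
    fix x y assume "x \<in> S" "y \<in> S" "x \<le> y"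
    then show "h y \<le> h x"
      using profile_factorD(5)[OF f] by (intro LIMSEQ_le[OF lim lim]) auto
  qed
  fix x assume x: "x \<in> S"
  show "0 \<le> h x" using profile_factorD(4)[OF f x] by (intro LIMSEQ_le_const[OF lim[OF x]]) auto
  fix y assume y: "y \<in> S"
  have m: "(x + y) / 2 \<in> S" using mem[of "1/2" x y] x y by (simp add: add_divide_distrib)
  show "h x * h y \<le> (h ((x + y) / 2))\<^sup>2"
    using profile_factorD(6)[OF f x y]
    by (intro LIMSEQ_le[OF tendsto_mult[OF lim[OF x] lim[OF y]] tendsto_power[OF lim[OF m]]]) auto
qed

lemma convergent_prod_linear:
  fixes c :: "nat \<Rightarrow> real"
  assumes "summable c" "\<And>j. 0 \<le> c j"
  shows "convergent_prod (\<lambda>j. 1 - c j * u)"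
proof (intro abs_convergent_prod_imp_convergent_prod summable_imp_abs_convergent_prod)
  have "(\<lambda>j. norm (1 - c j * u - 1)) = (\<lambda>j. c j * \<bar>u\<bar>)"
    using assms(2) by (simp add: abs_mult fun_eq_iff)
  then show "summable (\<lambda>j. norm (1 - c j * u - 1))"
    using assms(1) by (simp add: summable_mult2)
qed

lemma profile_factor_prodinf:
  fixes c :: "nat \<Rightarrow> real"
  assumes "convex S" "summable c" "\<And>j. 0 \<le> c j" "\<And>j u. u \<in> S \<Longrightarrow> c j * u \<le> 1"
  shows "profile_factor S (\<lambda>u. \<Prod>j. 1 - c j * u)"
proof (rule profile_factor_LIMSEQ)
  show "profile_factor S (\<lambda>u. \<Prod>j\<le>n. 1 - c j * u)" for n
    using assms by (intro profile_factor_prod profile_factor_linear) auto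
  show "(\<lambda>n. \<Prod>j\<le>n. 1 - c j * u) \<longlonglongrightarrow> (\<Prod>j. 1 - c j * u)" for u
    using assms by (intro convergent_prod_LIMSEQ convergent_prod_linear) auto
qed

text \<open>
  For \<open>0 < \<beta> < 1\<close> the factor \<open>(B - x) powr \<beta>\<close> is concave on its own; the zero at \<open>r < B\<close> compensates.
\<close>

lemma profile_factor_endpoint:
  assumes r: "0 < r" "r < B" and \<beta>: "0 \<le> \<beta>"
  shows "profile_factor {0..r} (\<lambda>x. (B - x) powr \<beta> * (1 - x / r))"
  unfolding profile_factor_def
proof (intro conjI ballI)
  define f' where "f' x = - \<beta> * (B - x) powr (\<beta> - 1) * (1 - x / r) - (B - x) powr \<beta> / r" for x
  define f'' where "f'' x = \<beta> * (\<beta> - 1) * (B - x) powr (\<beta> - 2) * (1 - x / r)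
      + 2 * \<beta> * (B - x) powr (\<beta> - 1) / r" for x
  have dp: "((\<lambda>x. (B - x) powr s) has_real_derivative - s * (B - x) powr (s - 1)) (at x)"
    if "x < B" for s x
    using DERIV_fun_powr[of "\<lambda>x. B - x" "-1" x s] that
    by (auto intro!: derivative_eq_intros)
  have dl: "((\<lambda>x. 1 - x / r) has_real_derivative - 1 / r) (at x)" for x
    using r by (auto intro!: derivative_eq_intros)
  show "convex_on {0..r} (\<lambda>x. (B - x) powr \<beta> * (1 - x / r))"
  proof (rule f''_ge0_imp_convex)
    fix x assume "x \<in> {0..r}"
    then have x: "0 \<le> x" "x \<le> r" "x < B" using r by auto
    show "((\<lambda>x. (B - x) powr \<beta> * (1 - x / r)) has_real_derivative f' x) (at x)"
      using DERIV_mult[OF dp[OF x(3), of \<beta>] dl] by (simp add: f'_def mult_ac)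
    have "((\<lambda>x. - \<beta> * ((B - x) powr (\<beta> - 1) * (1 - x / r)) - (B - x) powr \<beta> / r) has_real_derivative
        - \<beta> * (- (\<beta> - 1) * (B - x) powr (\<beta> - 1 - 1) * (1 - x / r) + - 1 / r * (B - x) powr (\<beta> - 1))
        - - \<beta> * (B - x) powr (\<beta> - 1) / r) (at x)"
      by (intro DERIV_diff DERIV_cmult DERIV_mult DERIV_cdivide dp dl x)
    then show "(f' has_real_derivative f'' x) (at x)"
      unfolding f'_def f''_def by (simp add: algebra_simps)
    have "(B - x) powr (\<beta> - 1) = (B - x) powr (\<beta> - 2) * (B - x)"
      using x powr_add[of "B - x" "\<beta> - 2" 1] by simp
    moreover have "1 - x / r = (r - x) / r" using r by (simp add: diff_divide_distrib)
    moreover have "\<beta> * (\<beta> - 1) * X * ((r - x) * i) + 2 * \<beta> * (X * (B - x)) * i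
        = \<beta> * X * i * ((\<beta> - 1) * (r - x) + 2 * (B - x))" for X i :: real
      by algebra
    ultimately have "f'' x = \<beta> * (B - x) powr (\<beta> - 2) / r * ((\<beta> - 1) * (r - x) + 2 * (B - x))"
      unfolding f''_def divide_inverse by simp
    \<comment> \<open>The possibly negative \<open>(\<beta> - 1) * (r - x)\<close> is absorbed by
      one copy of \<open>B - x\<close>, because \<open>r < B\<close>; this is how the zero at
      \<open>r\<close> restores convexity.\<close>
    moreover have "(\<beta> - 1) * (r - x) + 2 * (B - x) = \<beta> * (r - x) + (B - x) + (B - r)"
      by (simp add: algebra_simps)
    moreover have "0 \<le> \<beta> * (r - x) + (B - x) + (B - r)"
      using \<beta> r x by (intro add_nonneg_nonneg mult_nonneg_nonneg) auto
    ultimately show "0 \<le> f'' x" using \<beta> r by simp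
  qed simp
  show "antimono_on {0..r} (\<lambda>x. (B - x) powr \<beta> * (1 - x / r))"
    using r \<beta> by (auto intro!: monotone_onI mult_mono powr_mono2 divide_right_mono)
  fix x assume x: "x \<in> {0..r}"
  then show "0 \<le> (B - x) powr \<beta> * (1 - x / r)" using r by simp
  fix y assume y: "y \<in> {0..r}"
  have "profile_factor {0..r} (\<lambda>x. 1 - 1 / r * x)"
    using r by (intro profile_factor_linear) auto
  from profile_factorD(6)[OF this x y]
  have lin: "(1 - x / r) * (1 - y / r) \<le> (1 - ((x + y) / 2) / r)\<^sup>2"
    by (simp only: times_divide_eq_left mult_1)
  have "(B - (x + y) / 2)\<^sup>2 - (B - x) * (B - y) = ((x - y) / 2)\<^sup>2"
    by (simp add: power2_eq_square field_simps)
  then have "(B - x) * (B - y) \<le> (B - (x + y) / 2)\<^sup>2"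
    by (metis diff_ge_0_iff_ge zero_le_power2)
  then have "((B - x) * (B - y)) powr \<beta> \<le> ((B - (x + y) / 2)\<^sup>2) powr \<beta>"
    using x y r \<beta> by (intro powr_mono2) auto
  then have "(B - x) powr \<beta> * (B - y) powr \<beta> \<le> ((B - (x + y) / 2) powr \<beta>)\<^sup>2"
    using x y r by (simp add: powr_mult power2_eq_square)
  then show "(B - x) powr \<beta> * (1 - x / r) * ((B - y) powr \<beta> * (1 - y / r))
      \<le> ((B - (x + y) / 2) powr \<beta> * (1 - ((x + y) / 2) / r))\<^sup>2"
    using lin x y r
    by (intro midpoint_log_concave_mult[where f = "\<lambda>x. (B - x) powr \<beta>" and g = "\<lambda>x. 1 - x / r"]) auto
qed

section \<open>From the two endpoint cases to the locale\<close>

text \<open>Covers every case with a first zero \<open>r\<close>. The \<open>c j\<close> are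
  reciprocals of the later zeros, padded by 0 if there are finitely many, and \<open>s\<close> lies
  at or before the second zero. A finite endpoint has \<open>\<beta> = b/2\<close>; an infinite one
  takes \<open>\<beta> = 0\<close> and an auxiliary \<open>B\<close>, which makes the extra factor
  1.\<close>

lemma profile_finite_zero:
  fixes c :: "nat \<Rightarrow> real"
  assumes "0 < a" "0 \<le> lam" "0 < C" "0 < r" "r < s" "s \<le> B" "0 \<le> \<beta>" "ereal B \<le> L"
    and c: "summable c" "\<And>j. 0 \<le> c j" "\<And>j. c j * s \<le> 1"
    and Phi: "\<And>u. 0 < u \<Longrightarrow> u < B \<Longrightarrow> \<Phi> u = C * u powr (a/2) * (B - u) powr \<beta> * exp (- lam * u / 2)
                 * ((1 - u / r) * (\<Prod>j. 1 - c j * u))"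
    and "\<Phi> 0 = 0"
  shows "\<exists>g. profile a (ereal r) L g \<Phi> (g 0)"
proof
  define Q where "Q u = (\<Prod>j. 1 - c j * u)" for u
  define g where "g u = C * exp (- lam * u / 2) * ((B - u) powr \<beta> * (1 - u / r)) * Q u" for u
  have c1: "c j * u < 1" if "0 < u" "u < s" for j u
  proof (cases "c j = 0")
    case False
    then have "c j * u < c j * s" using c(2)[of j] that by simp
    then show ?thesis using c(3)[of j] by linarith
  qed simp
  \<comment> \<open>Two domains are needed: \<open>{0..s}\<close> gives continuity of
    \<open>Q\<close> beyond \<open>r\<close>, while \<open>{0..r}\<close> is where the other factors
    are controlled.\<close>
  have Qs: "profile_factor {0..s} Q"
    unfolding Q_def
    by (rule profile_factor_prodinf) (use c in \<open>auto intro: order_trans[OF mult_left_mono]\<close>)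
  have Qr: "profile_factor {0..r} Q"
    unfolding Q_def
    by (rule profile_factor_prodinf)
       (use c \<open>r < s\<close> in \<open>auto intro: order_trans[OF mult_left_mono[of _ s]]\<close>)
  have Qnz: "Q u \<noteq> 0" if "0 < u" "u < s" for u
    unfolding Q_def by (intro prodinf_nonzero convergent_prod_linear c) (use c1[OF that] in \<open>auto simp: less_le\<close>)
  have Qcont: "continuous_on {0<..<s} Q"
    by (intro convex_on_continuous convex_on_subset[OF profile_factorD(1)[OF Qs]]) auto
  have g: "profile_factor {0..r} g"
    unfolding g_def using assms
    by (intro profile_factor_mult profile_factor_const profile_factor_exp profile_factor_endpoint Qr) auto
  have Phi_g: "\<Phi> u = u powr (a/2) * g u" if "0 < u" "u < B" for u
    using Phi[OF that] by (simp add: g_def Q_def)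
  show "profile a (ereal r) L g \<Phi> (g 0)"
  proof
    fix u assume u: "0 < u" "ereal u < ereal r"
    have "g u \<noteq> 0" using u assms Qnz[of u] by (simp add: g_def)
    then show "0 < g u" using profile_factorD(4)[OF g, of u] u by simp
    show "g u \<le> g 0" using profile_factorD(5)[OF g, of 0 u] u by simp
    fix v assume v: "0 < v" "ereal v < ereal r"
    show "g u * g v \<le> (g ((u + v) / 2))\<^sup>2" using profile_factorD(6)[OF g, of u v] u v by simp
  next
    have "{u. 0 < u \<and> ereal u \<le> ereal r} = {0<..r}" by auto
    moreover have "convex_on {0<..r} g"
      by (rule convex_on_subset[OF profile_factorD(1)[OF g]]) auto
    ultimately show "convex_on {u. 0 < u \<and> ereal u \<le> ereal r} g" by simp
  next
    fix r' assume "ereal r = ereal r'"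
    then have r': "r' = r" by simp
    show "g r' = 0" using \<open>0 < r\<close> by (simp add: r' g_def)
    \<comment> \<open>The middle third between \<open>r\<close> and \<open>s\<close>, where neither
      \<open>1 - u / r\<close> nor \<open>Q\<close> vanishes.\<close>
    define x q where "x = r + (s - r) / 3" and "q = r + 2 * (s - r) / 3"
    have xq: "r < x" "x < q" "q < s" using \<open>r < s\<close> by (auto simp: x_def q_def field_simps)
    have "continuous_on {x..q} (\<lambda>u. u powr (a/2) * g u)"
      unfolding g_def using xq assms
      by (intro continuous_intros continuous_on_subset[OF Qcont]) auto
    then have "continuous_on {x..q} \<Phi>"
      by (rule continuous_on_eq) (use xq assms Phi_g in auto)
    moreover have "\<forall>u\<in>{x..q}. \<Phi> u \<noteq> 0"
    proof
      fix u assume "u \<in> {x..q}"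
      then have u: "0 < u" "r < u" "u < s" "u < B" using xq assms by auto
      show "\<Phi> u \<noteq> 0" using Phi_g[OF u(1,4)] Qnz[OF u(1,3)] u assms by (simp add: g_def)
    qed
    moreover have "ereal q \<le> L"
      using xq assms by (intro order_trans[OF _ \<open>ereal B \<le> L\<close>]) simp
    ultimately show "\<exists>x q. r' \<le> x \<and> x < q \<and> ereal q \<le> L \<and> continuous_on {x..q} \<Phi> \<and> (\<forall>u\<in>{x..q}. \<Phi> u \<noteq> 0)"
      unfolding r' using xq by (intro exI[of _ x] exI[of _ q]) auto
  next
    fix u assume "0 < u" "ereal u \<le> ereal r"
    then show "\<Phi> u = u powr (a/2) * g u" using assms by (intro Phi_g) auto
  qed (use assms in auto)
qed

text \<open>With the empty product, decay at infinity must come from the exponential; this is where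
  \<open>lam > 0\<close> enters.\<close>

lemma profile_no_zero:
  assumes "0 < a" "0 < lam" "0 < C"
    and Phi: "\<And>u. 0 < u \<Longrightarrow> \<Phi> u = C * u powr (a/2) * exp (- lam * u / 2)" and "\<Phi> 0 = 0"
  shows "\<exists>g. profile a \<infinity> \<infinity> g \<Phi> (g 0)"
proof
  define g where "g u = C * exp (- lam * u / 2)" for u
  have g: "profile_factor {0..} g"
    unfolding g_def using assms by (intro profile_factor_mult profile_factor_const profile_factor_exp) auto
  show "profile a \<infinity> \<infinity> g \<Phi> (g 0)"
  proof
    fix u :: real assume u: "0 < u"
    show "0 < g u" using assms by (simp add: g_def)
    show "g u \<le> g 0" using profile_factorD(5)[OF g, of 0 u] u by simp
    show "\<Phi> u = u powr (a/2) * g u" using Phi[OF u] by (simp add: g_def)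
    fix v :: real assume v: "0 < v"
    show "g u * g v \<le> (g ((u + v) / 2))\<^sup>2" using profile_factorD(6)[OF g, of u v] u v by simp
  next
    have "{u. 0 < u \<and> ereal u \<le> \<infinity>} = {0<..}" by auto
    moreover have "convex_on {0<..} g"
      by (rule convex_on_subset[OF profile_factorD(1)[OF g]]) auto
    ultimately show "convex_on {u. 0 < u \<and> ereal u \<le> \<infinity>} g" by simp
  next
    have "((\<lambda>u. C * u powr (a/2) * exp (- lam * u / 2)) \<longlongrightarrow> 0) at_top"
      using assms(1-3) by real_asymp
    moreover have "eventually (\<lambda>u. C * u powr (a/2) * exp (- lam * u / 2) = \<Phi> u) at_top"
      using eventually_gt_at_top[of 0] by eventually_elim (simp add: Phi)
    ultimately show "(\<Phi> \<longlongrightarrow> 0) at_top" by (rule Lim_transform_eventually)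
  qed (use assms in auto)
qed

lemma prod_split_first_zero:
  fixes \<zeta> :: "nat \<Rightarrow> real"
  assumes N: "1 \<le> N" and mono: "strict_mono_on {1..N} \<zeta>" and pos: "\<forall>j\<in>{1..N}. 0 < \<zeta> j"
    and B: "\<zeta> 1 < B" "\<forall>j\<in>{1..N}. \<zeta> j < B"
  obtains s c where "\<zeta> 1 < s" "s \<le> B" "summable c" "\<And>j. 0 \<le> c j" "\<And>j. c j * s \<le> 1"
    "\<And>u. (\<Prod>j=1..N. 1 - u / \<zeta> j) = (1 - u / \<zeta> 1) * (\<Prod>j. 1 - c j * u)"
proof -
  \<comment> \<open>The shift is 2 because zeros are numbered from 1 and the first is split off; the
    padding by 0 contributes factors 1.\<close>
  define c where "c j = (if j < N - 1 then 1 / \<zeta> (j + 2) else 0)" for j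
  define s where "s = (if N = 1 then B else \<zeta> 2)"
  have pos': "0 < \<zeta> (j + 2)" if "j < N - 1" for j using pos that by auto
  show ?thesis
  proof (rule that[of s c])
    show "\<zeta> 1 < s" using B N by (auto simp: s_def intro!: strict_mono_onD[OF mono])
    show "s \<le> B" using B N by (auto simp: s_def intro!: less_imp_le)
    show "summable c" by (rule summable_finite[of "{..<N - 1}"]) (auto simp: c_def)
    show "0 \<le> c j" for j using pos'[of j] by (auto simp: c_def intro: less_imp_le)
    show "c j * s \<le> 1" for j
    proof (cases "j < N - 1")
      case True
      then have "s = \<zeta> 2" "\<zeta> 2 \<le> \<zeta> (j + 2)"
        using strict_mono_on_leD[OF mono, of 2 "j + 2"] by (auto simp: s_def)
      then show ?thesis using True pos'[OF True] by (simp add: c_def)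
    qed (simp add: c_def)
    show "(\<Prod>j=1..N. 1 - u / \<zeta> j) = (1 - u / \<zeta> 1) * (\<Prod>j. 1 - c j * u)" for u
    proof -
      have "(\<Prod>j. 1 - c j * u) = (\<Prod>j<N - 1. 1 - c j * u)"
        by (rule prodinf_finite) (auto simp: c_def)
      also have "\<dots> = (\<Prod>j<N - 1. 1 - u / \<zeta> (Suc (Suc j)))"
        by (rule prod.cong) (auto simp: c_def)
      also have "(1 - u / \<zeta> 1) * \<dots> = (\<Prod>j<Suc (N - 1). 1 - u / \<zeta> (Suc j))"
        by (subst prod.lessThan_Suc_shift) simp
      also have "\<dots> = (\<Prod>j=1..N. 1 - u / \<zeta> j)"
        using N by (intro prod.reindex_bij_witness[of _ "\<lambda>j. j - 1" Suc]) auto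
      finally show ?thesis by simp
    qed
  qed
qed

lemma prodinf_split_first_zero:
  fixes \<zeta> :: "nat \<Rightarrow> real"
  assumes mono: "strict_mono_on {1..} \<zeta>" and pos: "\<forall>j\<ge>1. 0 < \<zeta> j"
    and sum: "summable (\<lambda>j. 1 / \<zeta> (Suc j))"
  obtains s c where "\<zeta> 1 < s" "summable c" "\<And>j. 0 \<le> c j" "\<And>j. c j * s \<le> 1"
    "\<And>u. (\<Prod>j. 1 - u / \<zeta> (Suc j)) = (1 - u / \<zeta> 1) * (\<Prod>j. 1 - c j * u)"
proof -
  define d where "d j = 1 / \<zeta> (Suc j)" for j
  have d: "summable d" "\<And>j. 0 \<le> d j" using sum pos by (auto simp: d_def[abs_def] intro!: less_imp_le)
  have dS: "summable (\<lambda>j. d (Suc j))" using d(1) by (simp add: summable_Suc_iff)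
  show ?thesis
  proof (rule that[of "\<zeta> 2" "\<lambda>j. d (Suc j)"])
    show "\<zeta> 1 < \<zeta> 2" by (rule strict_mono_onD[OF mono]) auto
    show "d (Suc j) * \<zeta> 2 \<le> 1" for j
    proof -
      have "\<zeta> 2 \<le> \<zeta> (Suc (Suc j))" using strict_mono_on_leD[OF mono, of 2 "Suc (Suc j)"] by simp
      then show ?thesis using pos by (simp add: d_def)
    qed
    \<comment> \<open>Splitting the partial products and passing to the limit also covers those
      \<open>u\<close> at which a factor vanishes, such as \<open>\<zeta> 1\<close>.\<close>
    show "(\<Prod>j. 1 - u / \<zeta> (Suc j)) = (1 - u / \<zeta> 1) * (\<Prod>j. 1 - d (Suc j) * u)" for u
    proof (rule LIMSEQ_unique)
      have "(\<lambda>n. \<Prod>j\<le>n. 1 - d j * u) \<longlonglongrightarrow> (\<Prod>j. 1 - d j * u)"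
        by (intro convergent_prod_LIMSEQ convergent_prod_linear d)
      then have "(\<lambda>n. \<Prod>j\<le>Suc n. 1 - d j * u) \<longlonglongrightarrow> (\<Prod>j. 1 - d j * u)"
        by (rule LIMSEQ_Suc)
      then show "(\<lambda>n. \<Prod>j\<le>Suc n. 1 - d j * u) \<longlonglongrightarrow> (\<Prod>j. 1 - u / \<zeta> (Suc j))"
        by (simp add: d_def)
      have "(\<lambda>n. (1 - u / \<zeta> 1) * (\<Prod>j\<le>n. 1 - d (Suc j) * u)) \<longlonglongrightarrow> (1 - u / \<zeta> 1) * (\<Prod>j. 1 - d (Suc j) * u)"
        by (intro tendsto_mult_left convergent_prod_LIMSEQ convergent_prod_linear d dS)
      then show "(\<lambda>n. \<Prod>j\<le>Suc n. 1 - d j * u) \<longlonglongrightarrow> (1 - u / \<zeta> 1) * (\<Prod>j. 1 - d (Suc j) * u)"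
        by (subst prod.atMost_Suc_shift) (simp add: d_def)
    qed
  qed (use d dS in auto)
qed

lemma profile_exists:
  assumes "0 < a" "0 \<le> lam" "0 < C" "\<Phi> 0 = 0"
    and "finite_endpoint a lam C \<Phi> z L \<or> infinite_endpoint a lam C \<Phi> z L"
  shows "\<exists>g. profile a z L g \<Phi> (g 0)"
  using assms(5)
proof
  assume "finite_endpoint a lam C \<Phi> z L"
  then obtain B b and N :: nat and \<zeta> :: "nat \<Rightarrow> real" where N: "1 \<le> N" and b: "0 \<le> b"
    and \<zeta>: "strict_mono_on {1..N} \<zeta>" "\<forall>j\<in>{1..N}. 0 < \<zeta> j" "\<forall>j\<in>{1..N}. \<zeta> j < B"
    and Phi: "\<And>u. 0 < u \<Longrightarrow> u < B \<Longrightarrow> \<Phi> u = C * u powr (a/2) * (B - u) powr (b/2) * exp (- lam * u / 2)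
               * (\<Prod>j=1..N. 1 - u / \<zeta> j)"
    and zL: "z = ereal (\<zeta> 1)" "L = ereal B"
    unfolding finite_endpoint_def by blast
  have \<zeta>1: "0 < \<zeta> 1" "\<zeta> 1 < B" using \<zeta> N by auto
  obtain s c where sc: "\<zeta> 1 < s" "s \<le> B" "summable c" "\<And>j. 0 \<le> c j" "\<And>j. c j * s \<le> 1"
    and split: "\<And>u. (\<Prod>j=1..N. 1 - u / \<zeta> j) = (1 - u / \<zeta> 1) * (\<Prod>j. 1 - c j * u)"
    using prod_split_first_zero[OF N \<zeta>(1,2) \<zeta>1(2) \<zeta>(3)] by blast
  have "0 \<le> b/2" "ereal B \<le> L" using b zL by auto
  then show ?thesis
    unfolding zL(1)
    by (intro profile_finite_zero[where lam = lam and C = C and s = s and c = c and B = B and \<beta> = "b/2"] assms sc \<zeta>1 Phi[unfolded split])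
next
  assume "infinite_endpoint a lam C \<Phi> z L"
  then consider (finite) N :: nat and \<zeta> :: "nat \<Rightarrow> real" where "L = \<infinity>" "N = 0 \<longrightarrow> lam > 0" "strict_mono_on {1..N} \<zeta>"
      "\<forall>j\<in>{1..N}. 0 < \<zeta> j"
      "\<forall>u>0. \<Phi> u = C * u powr (a/2) * exp (- lam * u / 2) * (\<Prod>j=1..N. 1 - u / \<zeta> j)"
      "z = (if N = 0 then \<infinity> else ereal (\<zeta> 1))"
    | (infinite) \<zeta> :: "nat \<Rightarrow> real" where "L = \<infinity>" "strict_mono_on {1..} \<zeta>" "\<forall>j\<ge>1. 0 < \<zeta> j"
      "summable (\<lambda>j. 1 / \<zeta> (Suc j))"
      "\<forall>u>0. \<Phi> u = C * u powr (a/2) * exp (- lam * u / 2) * (\<Prod>j. 1 - u / \<zeta> (Suc j))"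
      "z = ereal (\<zeta> 1)"
    unfolding infinite_endpoint_def
    apply (elim conjE disjE exE)
    subgoal by (rule that(1))
    subgoal by (rule that(2))
    done
  then show ?thesis
  proof cases
    case (finite N \<zeta>)
    show ?thesis
    proof (cases "N = 0")
      case True
      then show ?thesis using finite profile_no_zero[of a lam C \<Phi>] assms by simp
    next
      case False
      then have N: "1 \<le> N" by simp
      then have \<zeta>1: "0 < \<zeta> 1" using finite(4) by auto
      \<comment> \<open>An arbitrary point beyond all zeros; \<open>(B - u) powr 0\<close> is 1 for
        \<open>u < B\<close>.\<close>
      define B where "B = \<zeta> N + 1"
      have B: "\<forall>j\<in>{1..N}. \<zeta> j < B"
      proof
        fix j assume "j \<in> {1..N}"
        then have "\<zeta> j \<le> \<zeta> N" using strict_mono_on_leD[OF finite(3), of j N] by simp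
        then show "\<zeta> j < B" by (simp add: B_def)
      qed
      then have \<zeta>1B: "\<zeta> 1 < B" using N by auto
      obtain s c where sc: "\<zeta> 1 < s" "s \<le> B" "summable c" "\<And>j. 0 \<le> c j" "\<And>j. c j * s \<le> 1"
        and split: "\<And>u. (\<Prod>j=1..N. 1 - u / \<zeta> j) = (1 - u / \<zeta> 1) * (\<Prod>j. 1 - c j * u)"
        using prod_split_first_zero[OF N finite(3,4) \<zeta>1B B] by blast
      have z: "z = ereal (\<zeta> 1)" using finite(6) False by simp
      have Phi: "\<Phi> u = C * u powr (a/2) * (B - u) powr 0 * exp (- lam * u / 2)
          * ((1 - u / \<zeta> 1) * (\<Prod>j. 1 - c j * u))" if "0 < u" "u < B" for u
        using finite(5) that split[of u] by simp
      have "ereal B \<le> L" using finite(1) by simp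
      then show ?thesis
        unfolding z
        by (intro profile_finite_zero[where lam = lam and C = C and s = s and c = c and B = B and \<beta> = 0] assms sc \<zeta>1 Phi order_refl)
    qed
  next
    case (infinite \<zeta>)
    have \<zeta>1: "0 < \<zeta> 1" using infinite(3) by simp
    obtain s c where sc: "\<zeta> 1 < s" "summable c" "\<And>j. 0 \<le> c j" "\<And>j. c j * s \<le> 1"
      and split: "\<And>u. (\<Prod>j. 1 - u / \<zeta> (Suc j)) = (1 - u / \<zeta> 1) * (\<Prod>j. 1 - c j * u)"
      using prodinf_split_first_zero[OF infinite(2-4)] by blast
    \<comment> \<open>No point lies beyond all zeros when their reciprocals are summable, so
      \<open>s\<close> itself plays the part of \<open>B\<close>.\<close>
    have Phi: "\<Phi> u = C * u powr (a/2) * (s - u) powr 0 * exp (- lam * u / 2)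
        * ((1 - u / \<zeta> 1) * (\<Prod>j. 1 - c j * u))" if "0 < u" "u < s" for u
      using infinite(5) that split[of u] by simp
    have "ereal s \<le> L" using infinite(1) by simp
    then show ?thesis
      unfolding infinite(6)
      by (intro profile_finite_zero[where lam = lam and C = C and s = s and c = c and B = s and \<beta> = 0] assms sc \<zeta>1 Phi order_refl)
  qed
qed

theorem theorem5p2:
  fixes a lam C :: real and \<Phi> :: "real \<Rightarrow> real" and z L :: ereal
  assumes "a > 0" and "lam \<ge> 0" and "C > 0"
    and "finite_endpoint a lam C \<Phi> z L \<or> infinite_endpoint a lam C \<Phi> z L"
    and "\<Phi> 0 = 0"
  shows "(\<Phi> \<longlongrightarrow> 0) (at_right 0)
    \<and> (\<exists>!u1. is_arg_max \<Phi> (\<lambda>u. u \<in> einterval 0 z) u1)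
    \<and> (\<forall>u1 A. is_arg_max \<Phi> (\<lambda>u. u \<in> einterval 0 z) u1 \<and> A = \<Phi> u1 \<longrightarrow>
          (\<forall>t. 0 \<le> t \<and> t \<le> 1 + 2/a \<longrightarrow>
             \<Phi> (t * u1) / A \<ge> t powr (a/2) * (1 + a/2 * (1 - t)))
        \<and> (LBINT u=0..ereal u1. (\<Phi> u)\<^sup>2 / u) \<ge> A\<^sup>2 / a * R a
        \<and> (inverse_moment \<Phi> L < \<infinity> \<longrightarrow>
             A\<^sup>2 < a * enn2real (inverse_moment \<Phi> L) / R_star a))
    \<and> R a = (5 * a\<^sup>2 + 10 * a + 4) / (2 * (a + 1) * (a + 2))
    \<and> R_star a = (a + 2) / (2 * (a + 1)) * ((a + 2) / a) powr a
    \<and> R_star a > R a"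
proof -
  obtain g where "profile a z L g \<Phi> (g 0)"
    using profile_exists[OF assms(1-3,5,4)] by blast
  then interpret profile a z L g \<Phi> "g 0" .
  have ex1: "\<exists>!w. maximizer w" using maximizer_exists maximizer_unique by blast
  have R: "R a = (5 * a\<^sup>2 + 10 * a + 4) / (2 * (a + 1) * (a + 2))"
  proof -
    define p q where "p = a + 1" and "q = a + 2"
    have pq: "p > 0" "q > 0" using assms by (auto simp: p_def q_def)
    then have "1 + a / p + a\<^sup>2 / (2 * p * q) = (2 * p * q + 2 * a * q + a\<^sup>2) / (2 * p * q)"
      by (simp add: add_divide_distrib)
    also have "2 * p * q + 2 * a * q + a\<^sup>2 = 5 * a\<^sup>2 + 10 * a + 4"
      unfolding p_def q_def by algebra
    finally show ?thesis by (simp add: R_def p_def q_def)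
  qed
  have R_star: "R_star a = (a + 2) / (2 * (a + 1)) * ((a + 2) / a) powr a"
    using R_star_eq_kernel_prim kernel_prim_end \<open>a > 0\<close> by simp
  show ?thesis
    using tendsto_0 ex1 lower_bound integral_lower_bound inverse_moment_bound R R_star
      R_star_gt_R[OF \<open>a > 0\<close>] by blast
qed

end
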